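(* Let $\alpha>\beta>0$, $\eta=\beta/\alpha$, and let $x^\dagger\neq0$ be a sparse $\mathcal{R}_\eta$-minimum solution of $Ax=y$ such that for every $i\in\mathcal{I}(x^\dagger)$ there exists $\omega_i\in Y$ with $e_i=A^*\omega_i$. Let $M>0$ be a constant. Then there exist constants $c_1>c_2$ with $c_1>0$, and $c_3>0$, such that for every $x\in\ell_2$ with $\mathcal{R}_{\alpha,\beta}(x)\le M$, $$c_3(\alpha-\beta)\|x-x^\dagger\|_{\ell_1}\le \mathcal{R}_{\alpha,\beta}(x)-\mathcal{R}_{\alpha,\beta}(x^\dagger)+(c_1\alpha-c_2\beta)\|Ax-Ax^\dagger\|_Y .$$
   Context: $\ell_2$ is the real Hilbert space of square-summable sequences indexed by $\mathbb{N}$, $Y$ is a Hilbert space, $A:\ell_2\to Y$ is a bounded linear operator with adjoint $A^*$, and $y\in Y$. $e_i$ is the $i$th standard unit sequence. $\mathcal{R}_{\alpha,\beta}(x)=\alpha\|x\|_{\ell_1}^2-\beta\|x\|_{\ell_2}^2$ and $\mathcal{R}_\eta(x)=\|x\|_{\ell_1}^2-\eta\|x\|_{\ell_2}^2$ (so $\mathcal{R}_{\alpha,\beta}=\alpha\mathcal{R}_\eta$), with value $+\infty$ if $x\notin\ell_1$. An $\mathcal{R}_\eta$-minimum solution of $Ax=y$ is an element $x^\dagger\in\ell_2$ with $Ax^\dagger=y$ and $\mathcal{R}_\eta(x^\dagger)=\min\{\mathcal{R}_\eta(x): x\in\ell_2,\ Ax=y\}$. $\mathcal{I}(x^\dagger)=\{i\in\mathbb{N}: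 x_i^\dagger\ne0\}$, and sparse means that $\mathcal{I}(x^\dagger)$ is finite. *)

theory Defs
  imports "HOL-Analysis.Analysis"
begin

typedef ell2 = "{f :: nat \<Rightarrow> real. summable (\<lambda>i. (f i)\<^sup>2)}"
  morphisms coord Abs_ell2
  by (rule exI[of _ "\<lambda>_. 0"]) simp

setup_lifting type_definition_ell2

lemma summable_coord_sq: "summable (\<lambda>i. (coord x i)\<^sup>2)"
  using coord by auto

lemma ell2_eqI: "(\<And>i. coord x i = coord y i) \<Longrightarrow> x = y"
  by (simp add: coord_inject[symmetric] fun_eq_iff)

lemma summable_mult_of_sq:
  fixes f g :: "nat \<Rightarrow> real"
  assumes "summable (\<lambda>i. (f i)\<^sup>2)" "summable (\<lambda>i. (g i)\<^sup>2)"
  shows "summable (\<lambda>i. f i * g i)"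
proof (rule summable_comparison_test')
  show "summable (\<lambda>i. (f i)\<^sup>2 + (g i)\<^sup>2)"
    using assms by (rule summable_add)
  fix i
  have "2 * (\<bar>f i\<bar> * \<bar>g i\<bar>) \<le> (f i)\<^sup>2 + (g i)\<^sup>2"
    using sum_squares_bound[of "\<bar>f i\<bar>" "\<bar>g i\<bar>"] by (simp add: mult.assoc)
  moreover have "0 \<le> \<bar>f i\<bar> * \<bar>g i\<bar>" by simp
  ultimately show "norm (f i * g i) \<le> (f i)\<^sup>2 + (g i)\<^sup>2"
    unfolding real_norm_def abs_mult by linarith
qed

lemma summable_add_sq:
  fixes f g :: "nat \<Rightarrow> real"
  assumes "summable (\<lambda>i. (f i)\<^sup>2)" "summable (\<lambda>i. (g i)\<^sup>2)"
  shows "summable (\<lambda>i. (f i + g i)\<^sup>2)"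
proof -
  have "summable (\<lambda>i. ((f i)\<^sup>2 + (g i)\<^sup>2) + 2 * (f i * g i))"
    by (intro summable_add summable_mult summable_mult_of_sq assms)
  then show ?thesis by (simp add: power2_sum algebra_simps)
qed

lemma summable_scale_sq:
  fixes f :: "nat \<Rightarrow> real"
  assumes "summable (\<lambda>i. (f i)\<^sup>2)"
  shows "summable (\<lambda>i. (r * f i)\<^sup>2)"
  using summable_mult[OF assms, of "r\<^sup>2"] by (simp add: power_mult_distrib)

instantiation ell2 :: real_inner
begin

lift_definition zero_ell2 :: ell2 is "\<lambda>_. 0" by simp
lift_definition plus_ell2 :: "ell2 \<Rightarrow> ell2 \<Rightarrow> ell2" is "\<lambda>f g i. f i + g i"
  by (rule summable_add_sq)
lift_definition uminus_ell2 :: "ell2 \<Rightarrow> ell2" is "\<lambda>f i. - f i" by simp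
lift_definition minus_ell2 :: "ell2 \<Rightarrow> ell2 \<Rightarrow> ell2" is "\<lambda>f g i. f i - g i"
  using summable_add_sq[where g = "\<lambda>i. - g i" for g :: "nat \<Rightarrow> real"] by simp
lift_definition scaleR_ell2 :: "real \<Rightarrow> ell2 \<Rightarrow> ell2" is "\<lambda>r f i. r * f i"
  by (rule summable_scale_sq)
lift_definition inner_ell2 :: "ell2 \<Rightarrow> ell2 \<Rightarrow> real" is "\<lambda>f g. \<Sum>i. f i * g i" .

definition norm_ell2 :: "ell2 \<Rightarrow> real" where "norm_ell2 x = sqrt (inner x x)"
definition dist_ell2 :: "ell2 \<Rightarrow> ell2 \<Rightarrow> real" where "dist_ell2 x y = norm (x - y)"
definition sgn_ell2 :: "ell2 \<Rightarrow> ell2" where "sgn_ell2 x = inverse (norm x) *\<^sub>R x"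
definition uniformity_ell2 :: "(ell2 \<times> ell2) filter" where
  "uniformity_ell2 = (INF e\<in>{0<..}. principal {(x, y). dist x y < e})"
definition open_ell2 :: "ell2 set \<Rightarrow> bool" where
  "open_ell2 U = (\<forall>x\<in>U. eventually (\<lambda>(x', y). x' = x \<longrightarrow> y \<in> U) uniformity)"

instance
proof
  fix x y z :: ell2 and a b r :: real and U :: "ell2 set"
  show "x + y + z = x + (y + z)" by transfer (simp add: add.assoc)
  show "x + y = y + x" by transfer (simp add: add.commute)
  show "0 + x = x" by transfer simp
  show "- x + x = 0" by transfer simp
  show "x - y = x + - y" by transfer simp
  show "a *\<^sub>R (x + y) = a *\<^sub>R x + a *\<^sub>R y" by transfer (simp add: algebra_simps)
  show "(a + b) *\<^sub>R x = a *\<^sub>R x + b *\<^sub>R x" by transfer (simp add: algebra_simps)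
  show "a *\<^sub>R b *\<^sub>R x = (a * b) *\<^sub>R x" by transfer (simp add: algebra_simps)
  show "1 *\<^sub>R x = x" by transfer simp
  show "dist x y = norm (x - y)" by (rule dist_ell2_def)
  show "sgn x = inverse (norm x) *\<^sub>R x" by (rule sgn_ell2_def)
  show "uniformity = (INF e\<in>{0<..}. principal {(x, y :: ell2). dist x y < e})"
    by (rule uniformity_ell2_def)
  show "open U = (\<forall>x\<in>U. \<forall>\<^sub>F (x', y) in uniformity. x' = x \<longrightarrow> y \<in> U)"
    by (rule open_ell2_def)
  show "x \<bullet> y = y \<bullet> x" by transfer (simp add: mult.commute)
  show "(x + y) \<bullet> z = x \<bullet> z + y \<bullet> z"
    by transfer (simp add: distrib_right suminf_add summable_mult_of_sq)
  show "(r *\<^sub>R x) \<bullet> y = r * (x \<bullet> y)"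
    by transfer (simp add: mult.assoc suminf_mult summable_mult_of_sq)
  show "0 \<le> x \<bullet> x"
    by transfer (auto intro!: suminf_nonneg simp: power2_eq_square)
  show "x \<bullet> x = 0 \<longleftrightarrow> x = 0"
    by transfer (auto simp: power2_eq_square fun_eq_iff suminf_eq_zero_iff)
  show "norm x = sqrt (x \<bullet> x)" by (rule norm_ell2_def)
qed

end

lemma norm_ell2_sq: "(norm x)\<^sup>2 = (\<Sum>i. (coord x i)\<^sup>2)"
  unfolding power2_norm_eq_inner inner_ell2.rep_eq by (simp add: power2_eq_square)

lemma sum_coord_le_norm: "(\<Sum>i<k. (coord x i)\<^sup>2) \<le> (norm x)\<^sup>2"
  unfolding norm_ell2_sq by (rule sum_le_suminf) (auto simp: summable_coord_sq)

lemma coord_le_norm: "\<bar>coord x i\<bar> \<le> norm x"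
proof (rule power2_le_imp_le)
  have "(coord x i)\<^sup>2 \<le> (\<Sum>j<Suc i. (coord x j)\<^sup>2)"
    by (rule member_le_sum) auto
  also have "\<dots> \<le> (norm x)\<^sup>2" by (rule sum_coord_le_norm)
  finally show "\<bar>coord x i\<bar>\<^sup>2 \<le> (norm x)\<^sup>2" by simp
qed simp

instance ell2 :: complete_space
proof
  fix X :: "nat \<Rightarrow> ell2"
  assume X: "Cauchy X"
  have "Cauchy (\<lambda>n. coord (X n) i)" for i
  proof (rule metric_CauchyI)
    fix e :: real assume "0 < e"
    with X obtain N where N: "\<And>m n. m \<ge> N \<Longrightarrow> n \<ge> N \<Longrightarrow> dist (X m) (X n) < e"
      unfolding Cauchy_def by blast
    have "dist (coord (X m) i) (coord (X n) i) \<le> dist (X m) (X n)" for m n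
      using coord_le_norm[of "X m - X n" i]
      by (simp add: dist_norm minus_ell2.rep_eq)
    then show "\<exists>M. \<forall>m\<ge>M. \<forall>n\<ge>M. dist (coord (X m) i) (coord (X n) i) < e"
      using N by (meson le_less_trans)
  qed
  then have "\<forall>i. \<exists>a. (\<lambda>n. coord (X n) i) \<longlonglongrightarrow> a"
    using real_Cauchy_convergent unfolding convergent_def by blast
  then have "\<exists>l. \<forall>i. (\<lambda>n. coord (X n) i) \<longlonglongrightarrow> l i"
    by (rule choice)
  then obtain l where l: "\<And>i. (\<lambda>n. coord (X n) i) \<longlonglongrightarrow> l i" by blast
  have tail: "\<exists>N. \<forall>m\<ge>N. \<forall>k. (\<Sum>i<k. (coord (X m) i - l i)\<^sup>2) \<le> e\<^sup>2" if "0 < e" for e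
  proof -
    obtain N where N: "\<And>m n. m \<ge> N \<Longrightarrow> n \<ge> N \<Longrightarrow> dist (X m) (X n) < e"
      using X \<open>0 < e\<close> unfolding Cauchy_def by blast
    have "(\<Sum>i<k. (coord (X m) i - l i)\<^sup>2) \<le> e\<^sup>2" if "m \<ge> N" for m k
    proof (rule LIMSEQ_le_const2)
      show "(\<lambda>n. \<Sum>i<k. (coord (X m) i - coord (X n) i)\<^sup>2)
          \<longlonglongrightarrow> (\<Sum>i<k. (coord (X m) i - l i)\<^sup>2)"
        by (intro tendsto_intros l)
      have "(\<Sum>i<k. (coord (X m) i - coord (X n) i)\<^sup>2) \<le> e\<^sup>2" if "n \<ge> N" for n
      proof -
        have "(\<Sum>i<k. (coord (X m) i - coord (X n) i)\<^sup>2) \<le> (norm (X m - X n))\<^sup>2"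
          using sum_coord_le_norm[of "X m - X n" k] by (simp add: minus_ell2.rep_eq)
        also have "\<dots> \<le> e\<^sup>2"
          using N[OF \<open>m \<ge> N\<close> that] by (intro power_mono) (auto simp: dist_norm)
        finally show ?thesis .
      qed
      then show "\<exists>N. \<forall>n\<ge>N. (\<Sum>i<k. (coord (X m) i - coord (X n) i)\<^sup>2) \<le> e\<^sup>2" by blast
    qed
    then show ?thesis by blast
  qed
  have sq: "summable (\<lambda>i. (coord (X m) i - l i)\<^sup>2)"
    if "\<And>k. (\<Sum>i<k. (coord (X m) i - l i)\<^sup>2) \<le> B" for m B
    by (rule summableI_nonneg_bounded[OF _ that]) simp
  obtain m0 where "\<And>k. (\<Sum>i<k. (coord (X m0) i - l i)\<^sup>2) \<le> 1\<^sup>2"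
    using tail[of 1] by auto
  from summable_add_sq[OF summable_coord_sq[of "X m0"] summable_scale_sq[OF sq[OF this], of "-1"]]
  have "summable (\<lambda>i. (l i)\<^sup>2)" by simp
  then obtain L where L: "coord L = l" by (metis Abs_ell2_inverse mem_Collect_eq)
  have "X \<longlonglongrightarrow> L"
  proof (rule metric_LIMSEQ_I)
    fix e :: real assume "0 < e"
    then obtain N where N: "\<And>m k. m \<ge> N \<Longrightarrow> (\<Sum>i<k. (coord (X m) i - l i)\<^sup>2) \<le> (e/2)\<^sup>2"
      using tail[of "e/2"] by auto
    have "dist (X m) L < e" if "m \<ge> N" for m
    proof -
      have "(norm (X m - L))\<^sup>2 = (\<Sum>i. (coord (X m) i - l i)\<^sup>2)"
        by (simp add: norm_ell2_sq minus_ell2.rep_eq L)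
      also have "\<dots> \<le> (e/2)\<^sup>2"
        by (rule suminf_le_const[OF sq[OF N[OF that]] N[OF that]])
      finally have "norm (X m - L) \<le> e/2"
        by (rule power2_le_imp_le) (use \<open>0 < e\<close> in simp)
      then show ?thesis using \<open>0 < e\<close> by (simp add: dist_norm)
    qed
    then show "\<exists>N. \<forall>m\<ge>N. dist (X m) L < e" by blast
  qed
  then show "convergent X" by (rule convergentI)
qed

lift_definition unit_seq :: "nat \<Rightarrow> ell2" is "\<lambda>i j. if j = i then 1 else 0"
  by (rule summable_finite[of "{i}" for i]) auto

definition supp :: "ell2 \<Rightarrow> nat set" where
  "supp x = {i. coord x i \<noteq> 0}"

definition sparse_seq :: "ell2 \<Rightarrow> bool" where
  "sparse_seq x \<longleftrightarrow> finite (supp x)"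

text \<open>The \<open>\<ell>\<^sub>1\<close>-norm is extended-valued: it is \<open>\<infinity>\<close> exactly outside \<open>\<ell>\<^sub>1\<close>.\<close>

definition ell1_norm :: "ell2 \<Rightarrow> ereal" where
  "ell1_norm x = (\<Sum>i. ereal \<bar>coord x i\<bar>)"

definition R_ab :: "real \<Rightarrow> real \<Rightarrow> ell2 \<Rightarrow> ereal" where
  "R_ab \<alpha> \<beta> x =
    (if ell1_norm x < \<infinity> then ereal \<alpha> * (ell1_norm x)\<^sup>2 - ereal (\<beta> * (norm x)\<^sup>2) else \<infinity>)"

definition R_eta :: "real \<Rightarrow> ell2 \<Rightarrow> ereal" where
  "R_eta \<eta> x =
    (if ell1_norm x < \<infinity> then (ell1_norm x)\<^sup>2 - ereal (\<eta> * (norm x)\<^sup>2) else \<infinity>)"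

definition R_eta_min_solution :: "real \<Rightarrow> (ell2 \<Rightarrow> 'y) \<Rightarrow> 'y \<Rightarrow> ell2 \<Rightarrow> bool" where
  "R_eta_min_solution \<eta> A y x \<longleftrightarrow> is_arg_min (R_eta \<eta>) (\<lambda>z. A z = y) x"

end

theory Submission
  imports Defs
begin

text \<open>
  Write \<open>S\<close> for the finite support of \<open>x\<^sup>\<dagger>\<close> and \<open>h = x - x\<^sup>\<dagger>\<close>, let \<open>D\<close> be the
  \<open>\<ell>\<^sub>1\<close>-mass of \<open>h\<close> on \<open>S\<close> and \<open>t\<close> its mass off \<open>S\<close>, where \<open>h\<close> coincides with \<open>x\<close>.

  The source condition controls \<open>D\<close>: if \<open>e\<^sub>i = A\<^sup>* \<omega>\<^sub>i\<close>, then \<open>h\<^sub>i\<close> is the inner product of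
  \<open>A h\<close> with \<open>\<omega>\<^sub>i\<close>, so \<open>D \<le> W \<parallel>A h\<parallel>\<close> with \<open>W\<close> the sum of the \<open>\<parallel>\<omega>\<^sub>i\<parallel>\<close>
  (\<open>sum_coord_le_source_condition\<close>). Any loss proportional to \<open>D\<close> is therefore absorbed by the
  residual term of the estimate.

  The mass \<open>t\<close> is controlled by the penalty itself. If \<open>s\<close> and \<open>s\<^sup>\<dagger>\<close> denote the masses of \<open>x\<close> and
  \<open>x\<^sup>\<dagger>\<close> on \<open>S\<close>, the square \<open>(s + t)\<^sup>2\<close> contains the cross term \<open>2 s t\<close>, which is
  at least \<open>2 s\<^sup>\<dagger> t - 2 D t\<close>, and \<open>s\<^sup>\<dagger> > 0\<close> because \<open>x\<^sup>\<dagger> \<noteq> 0\<close>. So the penalty grows linearly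
  in \<open>t\<close>; the negative term \<open>\<beta> \<parallel>x\<parallel>\<^sup>2\<close> does no harm off \<open>S\<close>, as it contributes at most
  \<open>\<beta> t\<^sup>2 \<le> \<alpha> t\<^sup>2\<close> there. On \<open>S\<close> everything is locally Lipschitz, and the bound \<open>M\<close> on the
  penalty keeps \<open>x\<close> in a ball of \<open>\<ell>\<^sub>1\<close>, because \<open>(\<alpha> - \<beta>) \<parallel>x\<parallel>\<^sub>1\<^sup>2\<close> is at most the penalty.
  So all errors are constant multiples of \<open>D\<close> (\<open>penalty_growth\<close>).

  The residual needs only one positive factor, which is why \<open>c\<^sub>2 = 0\<close> is a possible choice.
\<close>

section \<open>Splitting series at a finite set\<close>

lemma suminf_split_finite:
  fixes f :: "nat \<Rightarrow> real"
  assumes "finite S" "summable f"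
  shows "summable (\<lambda>i. if i \<in> S then 0 else f i)"
    and "suminf f = sum f S + (\<Sum>i. if i \<in> S then 0 else f i)"
proof -
  have on: "(\<lambda>i. if i \<in> S then f i else 0) sums sum f S"
    by (rule sums_If_finite_set) (rule assms(1))
  from sums_diff[OF summable_sums[OF assms(2)] on]
  have off: "(\<lambda>i. if i \<in> S then 0 else f i) sums (suminf f - sum f S)"
    by (rule sums_cong[THEN iffD1, rotated]) auto
  show "summable (\<lambda>i. if i \<in> S then 0 else f i)"
    using off by (rule sums_summable)
  show "suminf f = sum f S + (\<Sum>i. if i \<in> S then 0 else f i)"
    using sums_unique[OF off] by simp
qed

text \<open>Each term is at most the whole sum \<open>N\<close>, so its square is at most \<open>N\<close> times the term.\<close>

lemma suminf_sq_le_sq_suminf_abs: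
  fixes f :: "nat \<Rightarrow> real"
  assumes "summable (\<lambda>i. \<bar>f i\<bar>)"
  shows "summable (\<lambda>i. (f i)\<^sup>2)" and "(\<Sum>i. (f i)\<^sup>2) \<le> (\<Sum>i. \<bar>f i\<bar>)\<^sup>2"
proof -
  let ?N = "\<Sum>i. \<bar>f i\<bar>"
  have le: "(f i)\<^sup>2 \<le> ?N * \<bar>f i\<bar>" for i
  proof -
    have "\<bar>f i\<bar> \<le> ?N"
      using sum_le_suminf[OF assms, of "{i}"] by simp
    from mult_right_mono[OF this, of "\<bar>f i\<bar>"] show ?thesis
      by (simp add: power2_eq_square abs_mult[symmetric])
  qed
  show sq: "summable (\<lambda>i. (f i)\<^sup>2)"
    by (rule summable_comparison_test'[OF summable_mult[OF assms, of ?N]]) (simp add: le)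
  have "(\<Sum>i. (f i)\<^sup>2) \<le> (\<Sum>i. ?N * \<bar>f i\<bar>)"
    by (rule suminf_le[OF le sq summable_mult[OF assms]])
  also have "\<dots> = ?N\<^sup>2"
    using suminf_mult[OF assms, of ?N] by (simp add: power2_eq_square)
  finally show "(\<Sum>i. (f i)\<^sup>2) \<le> ?N\<^sup>2" .
qed

section \<open>Riesz representation and the adjoint\<close>

lemma coord_sum: "coord (sum f I) j = (\<Sum>i\<in>I. coord (f i) j)"
  by (induction I rule: infinite_finite_induct) (auto simp: zero_ell2.rep_eq plus_ell2.rep_eq)

lemma inner_unit_seq: "x \<bullet> unit_seq i = coord x i"
proof -
  have "x \<bullet> unit_seq i = (\<Sum>j. if j = i then coord x j else 0)"
    unfolding inner_ell2.rep_eq unit_seq.rep_eq by (rule suminf_cong) simp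
  also have "\<dots> = coord x i"
    using sums_unique[OF sums_single[of i "coord x"]] by simp
  finally show ?thesis .
qed

lemma coord_sum_unit_seq:
  "coord (\<Sum>i<n. a i *\<^sub>R unit_seq i) j = (if j < n then a j else 0)"
  by (simp add: coord_sum scaleR_ell2.rep_eq unit_seq.rep_eq if_distrib[of "(*) _"] cong: if_cong)

lemma truncation_tendsto: "(\<lambda>n. \<Sum>i<n. coord x i *\<^sub>R unit_seq i) \<longlonglongrightarrow> x"
proof -
  let ?P = "\<lambda>n. \<Sum>i<n. coord x i *\<^sub>R unit_seq i"
  have "(norm (?P n - x))\<^sup>2 = (norm x)\<^sup>2 - (\<Sum>i<n. (coord x i)\<^sup>2)" for n
  proof -
    have "(norm (?P n - x))\<^sup>2 = (\<Sum>i. if i \<in> {..<n} then 0 else (coord x i)\<^sup>2)"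
      unfolding norm_ell2_sq
      by (rule suminf_cong) (simp add: minus_ell2.rep_eq coord_sum_unit_seq)
    then show ?thesis
      using suminf_split_finite(2)[OF finite_lessThan summable_coord_sq[of x], of n]
      by (simp add: norm_ell2_sq)
  qed
  moreover have "(\<lambda>n. (norm x)\<^sup>2 - (\<Sum>i<n. (coord x i)\<^sup>2)) \<longlonglongrightarrow> (norm x)\<^sup>2 - (norm x)\<^sup>2"
    unfolding norm_ell2_sq by (intro tendsto_intros summable_LIMSEQ summable_coord_sq)
  ultimately have "(\<lambda>n. (norm (?P n - x))\<^sup>2) \<longlonglongrightarrow> 0" by simp
  from tendsto_real_sqrt[OF this] have "(\<lambda>n. norm (?P n - x)) \<longlonglongrightarrow> 0" by simp
  then show ?thesis
    using LIM_zero_iff tendsto_norm_zero_iff by blast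
qed

text \<open>
  The representing sequence must be \<open>a\<^sub>i = g e\<^sub>i\<close>. Evaluating \<open>g\<close> at the truncation of \<open>a\<close>
  gives the squared norm of that truncation, so boundedness of \<open>g\<close> bounds these norms and \<open>a\<close>
  lies in \<open>\<ell>\<^sub>2\<close>. The two functionals then agree on truncations, which are dense.
\<close>

lemma riesz_representation_ell2:
  fixes g :: "ell2 \<Rightarrow> real"
  assumes "bounded_linear g"
  shows "\<exists>a. \<forall>x. g x = x \<bullet> a"
proof -
  interpret g: bounded_linear g by fact
  define a where "a i = g (unit_seq i)" for i
  obtain K where K: "0 \<le> K" "\<And>x. norm (g x) \<le> norm x * K"
    using g.nonneg_bounded by blast
  have bound: "(\<Sum>i<n. (a i)\<^sup>2) \<le> K\<^sup>2" for n
  proof -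
    define v where "v = (\<Sum>i<n. a i *\<^sub>R unit_seq i)"
    let ?Q = "\<Sum>i<n. (a i)\<^sup>2"
    have "v \<bullet> v = (\<Sum>i<n. a i * (v \<bullet> unit_seq i))"
      by (subst (2) v_def) (simp add: inner_sum_right)
    also have "\<dots> = ?Q"
      unfolding inner_unit_seq
      by (rule sum.cong) (auto simp: v_def coord_sum_unit_seq power2_eq_square)
    finally have vv: "(norm v)\<^sup>2 = ?Q" by (simp add: power2_norm_eq_inner)
    have "g v = ?Q"
      by (simp add: v_def g.sum g.scaleR a_def[symmetric] power2_eq_square)
    with K(2)[of v] have "norm v * norm v \<le> norm v * K"
      using vv by (simp add: power2_eq_square)
    then have "norm v \<le> K"
      using K(1) by (cases "norm v = 0") (auto simp: mult_le_cancel_left)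
    then show ?thesis
      unfolding vv[symmetric] by (intro power_mono) auto
  qed
  have "summable (\<lambda>i. (a i)\<^sup>2)"
    by (rule summableI_nonneg_bounded[OF _ bound]) simp
  then obtain b where b: "coord b = a" by (metis Abs_ell2_inverse mem_Collect_eq)
  have "g x = x \<bullet> b" for x
  proof (rule LIMSEQ_unique)
    let ?P = "\<lambda>n. \<Sum>i<n. coord x i *\<^sub>R unit_seq i"
    show "(\<lambda>n. g (?P n)) \<longlonglongrightarrow> g x"
      by (intro g.tendsto truncation_tendsto)
    have "g (?P n) = ?P n \<bullet> b" for n
      unfolding inner_commute[of "?P n" b]
      by (simp add: g.sum g.scaleR inner_sum_right inner_unit_seq b a_def)
    then show "(\<lambda>n. g (?P n)) \<longlonglongrightarrow> x \<bullet> b"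
      by (simp add: tendsto_inner[OF truncation_tendsto tendsto_const])
  qed
  then show ?thesis by blast
qed

text \<open>
  The constant \<open>adjoint\<close> is defined by choice and has its characteristic property only when some
  adjoint exists; the representation theorem supplies one.
\<close>

lemma inner_adjoint_ell2:
  fixes A :: "ell2 \<Rightarrow> 'y::real_inner"
  assumes "bounded_linear A"
  shows "A x \<bullet> \<omega> = x \<bullet> adjoint A \<omega>"
proof -
  have "\<exists>a. \<forall>x. A x \<bullet> z = x \<bullet> a" for z
    by (rule riesz_representation_ell2)
      (rule bounded_linear_compose[OF bounded_linear_inner_left assms])
  then have "\<exists>A'. \<forall>x z. A x \<bullet> z = x \<bullet> A' z"
    by metis
  then have "\<forall>x z. A x \<bullet> z = x \<bullet> adjoint A z"
    unfolding adjoint_def by (rule someI_ex)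
  then show ?thesis by blast
qed

lemma sum_coord_le_source_condition:
  fixes A :: "ell2 \<Rightarrow> 'y::real_inner"
  assumes A: "bounded_linear A"
    and source: "\<forall>i\<in>S. \<exists>\<omega>. unit_seq i = adjoint A \<omega>"
  shows "\<exists>W\<ge>0. \<forall>h. (\<Sum>i\<in>S. \<bar>coord h i\<bar>) \<le> W * norm (A h)"
proof -
  obtain \<omega> where \<omega>: "\<And>i. i \<in> S \<Longrightarrow> unit_seq i = adjoint A (\<omega> i)"
    using source by metis
  have "(\<Sum>i\<in>S. \<bar>coord h i\<bar>) \<le> (\<Sum>i\<in>S. norm (\<omega> i)) * norm (A h)" for h
    unfolding sum_distrib_right
  proof (rule sum_mono)
    fix i assume "i \<in> S"
    then have "coord h i = A h \<bullet> \<omega> i"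
      by (simp add: inner_adjoint_ell2[OF A] \<omega>[symmetric] inner_unit_seq)
    then show "\<bar>coord h i\<bar> \<le> norm (\<omega> i) * norm (A h)"
      using Cauchy_Schwarz_ineq2[of "A h" "\<omega> i"] by (simp add: mult.commute)
  qed
  then show ?thesis
    by (intro exI[of _ "\<Sum>i\<in>S. norm (\<omega> i)"]) (auto intro: sum_nonneg)
qed

section \<open>Growth of the penalty\<close>

lemma ell1_norm_real:
  assumes "summable (\<lambda>i. \<bar>coord x i\<bar>)"
  shows "ell1_norm x = ereal (\<Sum>i. \<bar>coord x i\<bar>)"
  unfolding ell1_norm_def using assms by (intro suminf_ereal') auto

lemma summable_of_ell1_norm_finite:
  assumes "ell1_norm x < \<infinity>"
  shows "summable (\<lambda>i. \<bar>coord x i\<bar>)"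
  using assms unfolding ell1_norm_def by (intro summable_ereal) auto

lemma R_ab_real:
  assumes "summable (\<lambda>i. \<bar>coord x i\<bar>)"
  shows "R_ab \<alpha> \<beta> x = ereal (\<alpha> * (\<Sum>i. \<bar>coord x i\<bar>)\<^sup>2 - \<beta> * (norm x)\<^sup>2)"
  using assms by (simp add: R_ab_def ell1_norm_real)

lemma ell1_bound_of_R_ab:
  assumes ab: "\<beta> < \<alpha>" "0 < \<beta>"
    and l1: "summable (\<lambda>i. \<bar>coord x i\<bar>)"
    and R: "R_ab \<alpha> \<beta> x \<le> ereal M"
  shows "(\<Sum>i. \<bar>coord x i\<bar>) \<le> sqrt (M / (\<alpha> - \<beta>))"
proof (rule real_le_rsqrt)
  let ?N = "\<Sum>i. \<bar>coord x i\<bar>"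
  have "\<beta> * (norm x)\<^sup>2 \<le> \<beta> * ?N\<^sup>2"
    using suminf_sq_le_sq_suminf_abs(2)[OF l1] ab by (simp add: norm_ell2_sq)
  moreover have "\<alpha> * ?N\<^sup>2 - \<beta> * (norm x)\<^sup>2 \<le> M"
    using R by (simp add: R_ab_real[OF l1])
  ultimately have "(\<alpha> - \<beta>) * ?N\<^sup>2 \<le> M" by (simp add: left_diff_distrib)
  then show "?N\<^sup>2 \<le> M / (\<alpha> - \<beta>)" using ab by (simp add: pos_le_divide_eq mult.commute)
qed

text \<open>
  With \<open>s\<close> and \<open>t\<close> the masses of \<open>f\<close> on and off \<open>S\<close>, the growth in \<open>t\<close> is that of the
  cross term \<open>2 \<alpha> s t\<close>. The coefficient of \<open>D\<close> collects the losses on \<open>S\<close>: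
  \<open>(\<alpha> + \<beta>) (C + p)\<close> comes from the Lipschitz estimates for \<open>\<alpha> s\<^sup>2\<close> and for the quadratic
  term, \<open>2 \<alpha> C\<close> from replacing \<open>s\<close> by \<open>p\<close> in the cross term, and \<open>2 \<alpha> p\<close> from
  completing \<open>t\<close> to the full \<open>\<ell>\<^sub>1\<close>-distance \<open>D + t\<close>.
\<close>

lemma penalty_growth:
  fixes f p0 :: "nat \<Rightarrow> real"
  defines "p \<equiv> \<Sum>i. \<bar>p0 i\<bar>"
  assumes ab: "\<beta> < \<alpha>" "0 < \<beta>"
    and S: "finite S" "\<And>i. i \<notin> S \<Longrightarrow> p0 i = 0"
    and f: "summable (\<lambda>i. \<bar>f i\<bar>)"
    and C: "(\<Sum>i. \<bar>f i\<bar>) \<le> C"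
  defines "D \<equiv> \<Sum>i\<in>S. \<bar>f i - p0 i\<bar>"
  shows "2 * \<alpha> * p * (\<Sum>i. \<bar>f i - p0 i\<bar>)
    \<le> (\<alpha> * (\<Sum>i. \<bar>f i\<bar>)\<^sup>2 - \<beta> * (\<Sum>i. (f i)\<^sup>2)) - (\<alpha> * p\<^sup>2 - \<beta> * (\<Sum>i. (p0 i)\<^sup>2))
      + ((\<alpha> + \<beta>) * (C + p) + 2 * \<alpha> * C + 2 * \<alpha> * p) * D"
proof -
  define s where "s = (\<Sum>i\<in>S. \<bar>f i\<bar>)"
  define off where "off i = (if i \<in> S then 0 else f i)" for i
  define t where "t = (\<Sum>i. \<bar>off i\<bar>)"
  have abs_off: "(\<lambda>i. if i \<in> S then 0 else \<bar>f i\<bar>) = (\<lambda>i. \<bar>off i\<bar>)"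
    and sq_off: "(\<lambda>i. if i \<in> S then 0 else (f i)\<^sup>2) = (\<lambda>i. (off i)\<^sup>2)"
    by (auto simp: off_def)
  have off: "summable (\<lambda>i. \<bar>off i\<bar>)"
    using suminf_split_finite(1)[OF S(1) f] by (simp only: abs_off)
  have p: "p = (\<Sum>i\<in>S. \<bar>p0 i\<bar>)"
    unfolding p_def using S by (intro suminf_finite) auto
  have p2: "(\<Sum>i. (p0 i)\<^sup>2) = (\<Sum>i\<in>S. (p0 i)\<^sup>2)"
    using S by (intro suminf_finite) auto
  have l1: "(\<Sum>i. \<bar>f i\<bar>) = s + t"
    using suminf_split_finite(2)[OF S(1) f] by (simp only: abs_off s_def t_def)
  have l2: "(\<Sum>i. (f i)\<^sup>2) \<le> (\<Sum>i\<in>S. (f i)\<^sup>2) + t\<^sup>2"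
  proof -
    have "(\<Sum>i. (f i)\<^sup>2) = (\<Sum>i\<in>S. (f i)\<^sup>2) + (\<Sum>i. (off i)\<^sup>2)"
      using suminf_split_finite(2)[OF S(1) suminf_sq_le_sq_suminf_abs(1)[OF f]]
      by (simp only: sq_off)
    then show ?thesis
      using suminf_sq_le_sq_suminf_abs(2)[OF off] by (simp add: t_def)
  qed
  have l1_diff: "(\<Sum>i. \<bar>f i - p0 i\<bar>) = D + t"
  proof -
    have fin: "summable (\<lambda>i. \<bar>p0 i\<bar>)"
      by (rule summable_finite[OF S(1)]) (simp add: S(2))
    have "summable (\<lambda>i. \<bar>f i - p0 i\<bar>)"
      by (rule summable_comparison_test'[OF summable_add[OF f fin]]) (simp add: abs_triangle_ineq4)
    from suminf_split_finite(2)[OF S(1) this] show ?thesis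
      unfolding D_def t_def
      by (simp add: off_def S(2) if_distrib[of abs] cong: if_cong)
  qed
  have nonneg: "0 \<le> t" "0 \<le> s" "0 \<le> p" "0 \<le> D"
    using off by (auto simp: t_def s_def p D_def intro!: sum_nonneg suminf_nonneg)
  have sC: "s \<le> C" and tC: "t \<le> C"
    using C l1 nonneg by auto
  have sp: "\<bar>s - p\<bar> \<le> D"
  proof -
    have "\<bar>s - p\<bar> \<le> (\<Sum>i\<in>S. \<bar>\<bar>f i\<bar> - \<bar>p0 i\<bar>\<bar>)"
      unfolding s_def p sum_subtractf[symmetric] by (rule sum_abs)
    also have "\<dots> \<le> D"
      unfolding D_def by (intro sum_mono abs_triangle_ineq3)
    finally show ?thesis .
  qed
  have square: "p\<^sup>2 - s\<^sup>2 \<le> (C + p) * D"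
  proof -
    have "p\<^sup>2 - s\<^sup>2 = (p - s) * (s + p)" by (simp add: power2_eq_square algebra_simps)
    also have "\<dots> \<le> D * (C + p)"
      using sp sC nonneg by (intro mult_mono) auto
    finally show ?thesis by (simp add: mult.commute)
  qed
  have quad: "(\<Sum>i\<in>S. (f i)\<^sup>2) - (\<Sum>i\<in>S. (p0 i)\<^sup>2) \<le> (C + p) * D"
    unfolding sum_subtractf[symmetric] D_def sum_distrib_left
  proof (rule sum_mono)
    fix i assume i: "i \<in> S"
    have "\<bar>f i\<bar> \<le> s" "\<bar>p0 i\<bar> \<le> p"
      unfolding s_def p using i S(1) by (auto intro: member_le_sum)
    then have le: "\<bar>f i + p0 i\<bar> \<le> C + p" using sC by linarith
    have "(f i)\<^sup>2 - (p0 i)\<^sup>2 \<le> \<bar>(f i + p0 i) * (f i - p0 i)\<bar>"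
      by (rule order_trans[OF _ abs_ge_self]) (simp add: power2_eq_square algebra_simps)
    also have "\<dots> \<le> (C + p) * \<bar>f i - p0 i\<bar>"
      unfolding abs_mult by (rule mult_right_mono[OF le]) simp
    finally show "(f i)\<^sup>2 - (p0 i)\<^sup>2 \<le> (C + p) * \<bar>f i - p0 i\<bar>" .
  qed
  have cross: "p * t \<le> s * t + C * D"
  proof -
    have "(p - s) * t \<le> D * C"
      using sp tC nonneg by (intro mult_mono) auto
    then show ?thesis by (simp add: algebra_simps)
  qed
  have "\<alpha> * (p\<^sup>2 - s\<^sup>2) \<le> \<alpha> * ((C + p) * D)"
    and "\<beta> * ((\<Sum>i. (f i)\<^sup>2) - (\<Sum>i\<in>S. (p0 i)\<^sup>2)) \<le> \<beta> * ((C + p) * D + t\<^sup>2)"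
    and "2 * \<alpha> * (p * t) \<le> 2 * \<alpha> * (s * t + C * D)"
    and "\<beta> * t\<^sup>2 \<le> \<alpha> * t\<^sup>2"
    using square quad cross l2 ab by (auto intro!: mult_left_mono mult_right_mono)
  then show ?thesis
    unfolding l1 l1_diff p2 by (simp add: power2_eq_square algebra_simps)
qed

section \<open>The error estimate\<close>

theorem lemma3p7:
  fixes A :: "ell2 \<Rightarrow> 'y::{real_inner, complete_space}"
    and y :: 'y
    and xdag :: ell2
    and \<alpha> \<beta> \<eta> M :: real
  assumes "bounded_linear A"
    and "\<alpha> > \<beta>" and "\<beta> > 0" and "\<eta> = \<beta> / \<alpha>"
    and "xdag \<noteq> 0"
    and "sparse_seq xdag"
    and "R_eta_min_solution \<eta> A y xdag"
    and "\<forall>i\<in>supp xdag. \<exists>\<omega>. unit_seq i = adjoint A \<omega>"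
    and "M > 0"
  shows "\<exists>c1 c2 c3 :: real. c1 > c2 \<and> c1 > 0 \<and> c3 > 0 \<and>
    (\<forall>x. R_ab \<alpha> \<beta> x \<le> ereal M \<longrightarrow>
      ereal (c3 * (\<alpha> - \<beta>)) * ell1_norm (x - xdag)
        \<le> R_ab \<alpha> \<beta> x - R_ab \<alpha> \<beta> xdag
          + ereal ((c1 * \<alpha> - c2 * \<beta>) * norm (A x - A xdag)))"
proof -
  interpret A: bounded_linear A by fact
  define S where "S = supp xdag"
  define p where "p = (\<Sum>i. \<bar>coord xdag i\<bar>)"
  define C where "C = sqrt (M / (\<alpha> - \<beta>))"
  have S: "finite S" "\<And>i. i \<notin> S \<Longrightarrow> coord xdag i = 0"
    using assms(6) by (auto simp: S_def sparse_seq_def supp_def)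
  have l1_dag: "summable (\<lambda>i. \<bar>coord xdag i\<bar>)"
    by (rule summable_finite[OF S(1)]) (simp add: S(2))
  have "0 < p"
  proof -
    obtain i where "coord xdag i \<noteq> 0"
      using assms(5) ell2_eqI[of xdag 0] by (auto simp: zero_ell2.rep_eq)
    then show ?thesis
      unfolding p_def by (intro suminf_pos2[OF l1_dag, of i]) auto
  qed
  obtain W where W: "0 \<le> W" "\<And>h. (\<Sum>i\<in>S. \<bar>coord h i\<bar>) \<le> W * norm (A h)"
    using sum_coord_le_source_condition[OF assms(1,8)] unfolding S_def by blast
  define B where "B = (\<alpha> + \<beta>) * (C + p) + 2 * \<alpha> * C + 2 * \<alpha> * p"
  have "0 < C" using assms by (simp add: C_def)
  then have "0 \<le> B" using assms \<open>0 < p\<close> by (simp add: B_def)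
  \<comment> \<open>The summand \<open>1\<close> keeps \<open>c1\<close> positive in case \<open>W = 0\<close>.\<close>
  define c1 where "c1 = (B * W + 1) / \<alpha>"
  define c3 where "c3 = 2 * \<alpha> * p / (\<alpha> - \<beta>)"
  have c1: "0 < c1"
    using \<open>0 \<le> B\<close> W(1) assms by (auto simp: c1_def intro!: divide_pos_pos add_nonneg_pos)
  have c3: "0 < c3" using assms \<open>0 < p\<close> by (simp add: c3_def)
  have "ereal (c3 * (\<alpha> - \<beta>)) * ell1_norm (x - xdag)
      \<le> R_ab \<alpha> \<beta> x - R_ab \<alpha> \<beta> xdag + ereal ((c1 * \<alpha> - 0 * \<beta>) * norm (A x - A xdag))"
    if R: "R_ab \<alpha> \<beta> x \<le> ereal M" for x
  proof -
    have l1: "summable (\<lambda>i. \<bar>coord x i\<bar>)"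
      using R by (intro summable_of_ell1_norm_finite) (auto simp: R_ab_def split: if_splits)
    have l1_diff: "summable (\<lambda>i. \<bar>coord (x - xdag) i\<bar>)"
      by (rule summable_comparison_test'[OF summable_add[OF l1 l1_dag]])
        (simp add: minus_ell2.rep_eq abs_triangle_ineq4)
    let ?D = "\<Sum>i\<in>S. \<bar>coord (x - xdag) i\<bar>"
    have "B * ?D \<le> B * (W * norm (A (x - xdag)))"
      by (rule mult_left_mono[OF W(2) \<open>0 \<le> B\<close>])
    also have "\<dots> \<le> c1 * \<alpha> * norm (A x - A xdag)"
    proof -
      have "c1 * \<alpha> = B * W + 1" using assms by (simp add: c1_def)
      then show ?thesis by (simp add: A.diff algebra_simps)
    qed
    finally have residual: "B * ?D \<le> c1 * \<alpha> * norm (A x - A xdag)" .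
    have "2 * \<alpha> * p * (\<Sum>i. \<bar>coord (x - xdag) i\<bar>)
      \<le> (\<alpha> * (\<Sum>i. \<bar>coord x i\<bar>)\<^sup>2 - \<beta> * (norm x)\<^sup>2) - (\<alpha> * p\<^sup>2 - \<beta> * (norm xdag)\<^sup>2) + B * ?D"
      using penalty_growth[OF assms(2,3) S l1 ell1_bound_of_R_ab[OF assms(2,3) l1 R]]
      by (simp only: norm_ell2_sq minus_ell2.rep_eq p_def B_def C_def)
    moreover have "c3 * (\<alpha> - \<beta>) = 2 * \<alpha> * p" using assms by (simp add: c3_def)
    ultimately show ?thesis
      using residual
      by (simp add: R_ab_real l1 l1_dag ell1_norm_real[OF l1_diff] p_def)
  qed
  then show ?thesis
    using c1 c3 by blast
qed

end
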